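(* Let $d \ge 1$ and $n \ge d+2$ be integers. There is a coupling $(\{x_i\}_{i=1}^n, \{y_i\}_{i=1}^n)$ of the distributions $\rho_n^d$ and $\rho_n^{n-d-1}$ such that $\{x_i\}_{i=1}^n$ and $\{y_i\}_{i=1}^n$ are in Gale dual position, i.e. $\{y_i\}_{i=1}^n$ is a Gale dual of $\{x_i\}_{i=1}^n$.
   Context: For positive integers $m, n$, $\rho_n^m$ is the distribution of the $m \times n$ random matrix $Z A$, where $Z$ is an $m\times n$ matrix of i.i.d. standard Gaussian entries and $A = I_n - \frac1n J_n$, with $I_n$ the $n\times n$ identity matrix and $J_n$ the $n \times n$ all-ones matrix. A sample from $\rho_n^m$ is identified with the sequence of its $n$ columns, which are points in $\mathbb{R}^m$; equivalently, one samples $n$ independent standard Gaussian points in $\mathbb{R}^m$ and subtracts their barycenter from each. Gale dual: given points $x_1,\dots,x_n \in \mathbb{R}^d$ (in general position), let $M$ be the $(d+1)\times n$ matrix whose columns are the $x_i$ with an additional row of all $1$'s appended. Let $N$ be any $n \times (n-d-1)$ matrix whose columns form a basis of $\ker(M)$. The rows $y_1,\dots,y_n \in \mathbb{R}^{n-d-1}$ of $N$ are called a Gale dual of $x_1,\dots,x_n$ (it is unique only up to the choice of basis of $\ker(M)$). A coupling of two distributions is a pair of random variables defined on a common probability space whose marginal distributions are the two given distributions. *)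

theory Defs
  imports "HOL-Probability.Probability"
begin

definition centering_matrix :: "real^'n^'n" where
  "centering_matrix = mat 1 - (1 / real CARD('n)) *\<^sub>R (\<chi> i j. 1)"

(* The m x n matrices are the type real^'n^'m, so the parameters m = CARD('m) and n = CARD('n)
   of the distribution rho are carried by the type; the n points are the columns. *)
definition rho :: "(real^'n^'m) measure" where
  "rho = distr (\<Pi>\<^sub>M (_ :: 'm \<times> 'n)\<in>UNIV. std_normal_distribution) borel
           (\<lambda>z. (\<chi> i j. z (i, j)) ** centering_matrix)"

(* No d + 1 of the points lie on a common hyperplane; injectivity is needed because
   affine dependence is a property of the set of points rather than of the family. *)
definition general_position :: "('n::finite \<Rightarrow> real^'d) \<Rightarrow> bool" where
  "general_position x \<longleftrightarrow>
     (\<forall>S. card S = CARD('d) + 1 \<longrightarrow> inj_on x S \<and> \<not> affine_dependent (x ` S))"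

(* The row None is the appended row of ones. *)
definition gale_matrix :: "('n \<Rightarrow> real^'d) \<Rightarrow> real^'n^('d option)" where
  "gale_matrix x = (\<chi> r j. case r of None \<Rightarrow> 1 | Some i \<Rightarrow> x j $ i)"

definition columns_basis_of :: "real^'k^'n \<Rightarrow> (real^'n) set \<Rightarrow> bool" where
  "columns_basis_of N V \<longleftrightarrow>
     inj (\<lambda>c. column c N) \<and> independent (columns N) \<and> span (columns N) = V"

definition gale_dual :: "('n::finite \<Rightarrow> real^'d) \<Rightarrow> ('n \<Rightarrow> real^'k) \<Rightarrow> bool" where
  "gale_dual x y \<longleftrightarrow> general_position x \<and>
     (\<exists>N :: real^'k^'n. columns_basis_of N {v. gale_matrix x *v v = 0} \<and> (\<forall>i. y i = row i N))"

definition coupling ::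
  "'w measure \<Rightarrow> ('w \<Rightarrow> 'a) \<Rightarrow> ('w \<Rightarrow> 'b) \<Rightarrow> 'a measure \<Rightarrow> 'b measure \<Rightarrow> bool" where
  "coupling W X Y \<mu> \<nu> \<longleftrightarrow> prob_space W \<and>
     X \<in> measurable W \<mu> \<and> distr W \<mu> X = \<mu> \<and> Y \<in> measurable W \<nu> \<and> distr W \<nu> Y = \<nu>"

lemma measurable_rho_map:
  "(\<lambda>z. (\<chi> i j. z (i, j)) ** (centering_matrix :: real^'n^'n) :: real^'n^'m)
     \<in> borel_measurable (\<Pi>\<^sub>M (_ :: 'm \<times> 'n)\<in>UNIV. std_normal_distribution)"
proof -
  have [measurable]: "(\<lambda>z. z p) \<in> borel_measurable (\<Pi>\<^sub>M (_ :: 'm \<times> 'n)\<in>UNIV. std_normal_distribution)"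
    for p :: "'m \<times> 'n"
    using measurable_component_singleton[of p UNIV "\<lambda>_. std_normal_distribution"] by simp
  show ?thesis
    unfolding matrix_matrix_mult_def
    by (subst borel_measurable_euclidean_space) (auto simp: Basis_vec_def inner_axis)
qed

lemma prob_space_rho: "prob_space (rho :: (real^'n^'m) measure)"
proof -
  interpret product_prob_space "\<lambda>_ :: 'm \<times> 'n. std_normal_distribution" UNIV
    by (intro product_prob_spaceI prob_space_normal_density) simp
  show ?thesis
    unfolding rho_def by (rule P.prob_space_distr[OF measurable_rho_map])
qed

lemma sets_rho [simp, measurable_cong]: "sets rho = sets borel"
  by (simp add: rho_def)

end

theory Submission
  imports Defs
begin

text \<open>
  Let \<open>x\<close>, \<open>y\<close> be independent samples of the two distributions and let \<open>H\<close> be an independent Haar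
  distributed isometry of the hyperplane orthogonal to the all-ones vector, with an orthonormal basis
  \<open>e\<close>. The Gram-Schmidt process carries the rows of \<open>x\<close> isometrically into the span of the first \<open>d\<close>
  vectors of \<open>e\<close>, and the rows of \<open>y\<close> into the span of the remaining \<open>n - d - 1\<close>; then \<open>H\<close> is
  applied to both. The two row spaces are orthogonal complements of each other in the hyperplane, which is
  Gale duality. Each marginal is unchanged: for fixed \<open>x\<close> the first step is an isometry, which the
  invariance of \<open>H\<close> absorbs, and for fixed \<open>H\<close> the Gaussian distribution is rotation invariant.
  The Haar isometry itself comes from the Gram-Schmidt frame of a third Gaussian sample.
  The degenerate samples form a null set, which is removed from the probability space.
\<close>

section \<open>Rotation invariance of Gaussian matrices\<close>

lemma orthogonal_transformation_measurable:
  fixes Q :: "'a::euclidean_space \<Rightarrow> 'a"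
  assumes "orthogonal_transformation Q"
  shows "Q \<in> borel_measurable borel"
  using linear_continuous_on[of Q UNIV] orthogonal_transformation_linear[OF assms]
  by (intro borel_measurable_continuous_onI) (simp add: linear_linear)

text \<open>Translation invariance and Tonelli determine the image measure up to the factor by which it scales
  the unit ball, and \<open>Q\<close> preserves that ball.\<close>

lemma distr_lborel_orthogonal_transformation:
  fixes Q :: "'a::euclidean_space \<Rightarrow> 'a"
  assumes Q: "orthogonal_transformation Q"
  shows "distr lborel borel Q = lborel"
proof (rule measure_eqI)
  have lin: "linear Q" using Q by (rule orthogonal_transformation_linear)
  have Qm [measurable]: "Q \<in> borel_measurable borel"
    using Q by (rule orthogonal_transformation_measurable)
  have shift: "(\<integral>\<^sup>+x. f (x + t) \<partial>lborel) = (\<integral>\<^sup>+x. f x \<partial>lborel)"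
    if [measurable]: "f \<in> borel_measurable borel" for f :: "'a \<Rightarrow> ennreal" and t
    by (subst (2) lborel_affine[of 1 t]) (simp_all add: nn_integral_density nn_integral_distr add.commute)
  have neg: "(\<integral>\<^sup>+x. f (y - x) \<partial>lborel) = (\<integral>\<^sup>+x. f x \<partial>lborel)"
    if [measurable]: "f \<in> borel_measurable borel" for f :: "'a \<Rightarrow> ennreal" and y
    by (subst (2) lborel_affine[of "-1" y]) (simp_all add: nn_integral_density nn_integral_distr)
  fix A assume "A \<in> sets (distr lborel borel Q)"
  then have [measurable]: "A \<in> sets borel" by simp
  define B where "B = ball (0::'a) 1"
  have [measurable]: "B \<in> sets borel" by (simp add: B_def)
  define f where "f = (indicator A :: 'a \<Rightarrow> ennreal)"
  define g where "g = (indicator B :: 'a \<Rightarrow> ennreal)"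
  have [measurable]: "f \<in> borel_measurable borel" "g \<in> borel_measurable borel"
    by (simp_all add: f_def g_def)
  have gQ: "g (Q x) = g x" for x
    using Q by (simp add: g_def B_def indicator_def orthogonal_transformation_norm)
  have mass: "(\<integral>\<^sup>+x. g x \<partial>lborel) = emeasure lborel B" by (simp add: g_def)
  have surj: "Q (inv Q y) = y" for y
    using orthogonal_transformation_surj[OF Q] by (simp add: surj_f_inv_f)
  \<comment> \<open>\<open>y\<close> is translated by \<open>Q x\<close> before the exchange of
    integrals and \<open>x\<close> by \<open>inv Q y\<close> after it. Then \<open>Q x\<close>
    inside \<open>f\<close> is a mere translation for the integral over \<open>y\<close>, and
    \<open>g\<close> does not see \<open>Q\<close>.\<close>
  have "(\<integral>\<^sup>+x. f (Q x) \<partial>lborel) * (\<integral>\<^sup>+y. g y \<partial>lborel) = (\<integral>\<^sup>+x. \<integral>\<^sup>+y. f (Q x) * g (y + Q x) \<partial>lborel \<partial>lborel)"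
    by (simp add: nn_integral_cmult nn_integral_multc shift[of g])
  also have "\<dots> = (\<integral>\<^sup>+y. \<integral>\<^sup>+x. f (Q x) * g (y + Q x) \<partial>lborel \<partial>lborel)"
    by (rule lborel_pair.Fubini') simp
  also have "\<dots> = (\<integral>\<^sup>+y. \<integral>\<^sup>+x. f (Q x - y) * g (Q x) \<partial>lborel \<partial>lborel)"
  proof (rule nn_integral_cong)
    fix y show "(\<integral>\<^sup>+x. f (Q x) * g (y + Q x) \<partial>lborel) = (\<integral>\<^sup>+x. f (Q x - y) * g (Q x) \<partial>lborel)"
      using shift[of "\<lambda>x. f (Q x - y) * g (Q x)" "inv Q y"]
      by (simp add: linear_add[OF lin] surj add.commute)
  qed
  also have "\<dots> = (\<integral>\<^sup>+x. \<integral>\<^sup>+y. f (Q x - y) * g (Q x) \<partial>lborel \<partial>lborel)"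
    by (rule lborel_pair.Fubini') simp
  also have "\<dots> = (\<integral>\<^sup>+x. f x \<partial>lborel) * (\<integral>\<^sup>+x. g x \<partial>lborel)"
    by (simp add: nn_integral_multc nn_integral_cmult neg[of f] gQ)
  finally have eq: "(\<integral>\<^sup>+x. f (Q x) \<partial>lborel) * emeasure lborel B = emeasure lborel A * emeasure lborel B"
    by (simp add: mass f_def)
  have "emeasure lborel B \<noteq> 0" "emeasure lborel B \<noteq> \<infinity>"
    using emeasure_lborel_ball_finite[of "0::'a" 1] content_ball_pos[of 1 "0::'a"]
    by (auto simp: B_def measure_def)
  then have "(\<integral>\<^sup>+x. f (Q x) \<partial>lborel) = emeasure lborel A"
    using eq by (simp add: mult.commute[of _ "emeasure lborel B"] ennreal_mult_cancel_left)
  moreover have "(\<integral>\<^sup>+x. f (Q x) \<partial>lborel) = (\<integral>\<^sup>+x. f x \<partial>distr lborel borel Q)"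
    by (simp add: nn_integral_distr)
  ultimately show "emeasure (distr lborel borel Q) A = emeasure lborel A"
    by (simp add: f_def)
qed simp

section \<open>The Gaussian density on the space of matrices\<close>

definition gaussian :: "(real^'n^'m) measure" where
  "gaussian = density lborel (\<lambda>v. ennreal ((1 / sqrt (2 * pi)) ^ CARD('m \<times> 'n) * exp (- (norm v)\<^sup>2 / 2)))"

lemma sets_gaussian [simp, measurable_cong]: "sets gaussian = sets borel"
  and space_gaussian [simp]: "space gaussian = UNIV"
  by (simp_all add: gaussian_def)

lemma measurable_vec_component [measurable]:
  "(\<lambda>v::'a::euclidean_space^'m. v $ i) \<in> borel_measurable borel"
  by (intro borel_measurable_continuous_onI continuous_intros)

lemma measurable_vec_of_entries [measurable]:
  assumes [measurable]: "\<And>i. (\<lambda>z. f z i :: 'a::euclidean_space) \<in> borel_measurable M"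
  shows "(\<lambda>z. \<chi> i. f z i :: 'a^'m) \<in> borel_measurable M"
  by (subst borel_measurable_euclidean_space) (auto simp: Basis_vec_def inner_axis)

lemma norm_matrix_sqr: "(norm (v :: real^'n^'m))\<^sup>2 = (\<Sum>p\<in>UNIV. (v $ fst p $ snd p)\<^sup>2)"
  unfolding power2_norm_eq_inner inner_vec_def
  by (simp add: power2_eq_square sum.cartesian_product case_prod_unfold)

text \<open>Here \<open>f\<close> takes the coordinate functional, not a coordinate, so that an
  instance can combine the coordinates of two matrices, as the side lengths of a box
  require.\<close>

lemma prod_Basis_matrix:
  "(\<Prod>b\<in>(Basis::(real^'n^'m) set). f (\<lambda>v. v \<bullet> b)) = (\<Prod>p\<in>UNIV. f (\<lambda>v. v $ fst p $ snd p))"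
proof -
  define B where "B = (\<lambda>p::'m \<times> 'n. axis (fst p) (axis (snd p) (1::real)))"
  have "(Basis::(real^'n^'m) set) = range B"
    by (fastforce simp: Basis_vec_def B_def image_iff)
  then have "(\<Prod>b\<in>(Basis::(real^'n^'m) set). f (\<lambda>v. v \<bullet> b)) = (\<Prod>b\<in>range B. f (\<lambda>v. v \<bullet> b))"
    by (rule prod.cong) simp
  also have "(\<Prod>b\<in>range B. f (\<lambda>v. v \<bullet> b)) = (\<Prod>p\<in>UNIV. f (\<lambda>v. v \<bullet> B p))"
    by (rule prod.reindex[unfolded comp_def]) (auto simp: inj_on_def B_def axis_eq_axis)
  finally show ?thesis by (simp add: B_def inner_axis)
qed

text \<open>Lebesgue measure is determined by the volumes of boxes, and the entries of the matrices
  in a box range over a product of intervals.\<close>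

lemma distr_PiM_lborel_matrix:
  "distr (\<Pi>\<^sub>M _\<in>UNIV. lborel) borel (\<lambda>z. \<chi> i j. z (i, j)) = (lborel :: (real^'n^'m) measure)"
proof (rule lborel_eqI[symmetric])
  interpret product_sigma_finite "\<lambda>_::'m \<times> 'n. lborel :: real measure" ..
  fix l u :: "real^'n^'m"
  assume le: "\<And>b. b \<in> Basis \<Longrightarrow> l \<bullet> b \<le> u \<bullet> b"
  have le': "l $ i $ j \<le> u $ i $ j" for i j
    using le[of "axis i (axis j 1)"] by (simp add: inner_axis axis_in_Basis_iff)
  have box: "box l u = {v. \<forall>i j. l $ i $ j < v $ i $ j \<and> v $ i $ j < u $ i $ j}"
    by (auto simp: box_def Basis_vec_def inner_axis)
  have "emeasure (distr (\<Pi>\<^sub>M _\<in>UNIV. lborel) borel (\<lambda>z. \<chi> i j. z (i, j))) (box l u) =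
      emeasure (\<Pi>\<^sub>M _\<in>UNIV. lborel) (\<Pi>\<^sub>E p\<in>(UNIV::('m\<times>'n) set). {l $ fst p $ snd p <..< u $ fst p $ snd p})"
    by (subst emeasure_distr) (auto intro!: arg_cong2[where f=emeasure] simp: box space_PiM PiE_iff)
  also have "\<dots> = (\<Prod>p\<in>UNIV. ennreal (u $ fst p $ snd p - l $ fst p $ snd p))"
    by (subst emeasure_PiM) (auto simp: le')
  also have "\<dots> = ennreal (\<Prod>b\<in>Basis. (u - l) \<bullet> b)"
    by (simp add: prod_ennreal le' inner_diff_left prod_Basis_matrix[of "\<lambda>f. f u - f l"])
  finally show "emeasure (distr (\<Pi>\<^sub>M _\<in>UNIV. lborel) borel (\<lambda>z. \<chi> i j. z (i, j))) (box l u) = ennreal (\<Prod>b\<in>Basis. (u - l) \<bullet> b)" .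
qed simp

lemma PiM_std_normal:
  "(\<Pi>\<^sub>M _\<in>(UNIV::'i::finite set). std_normal_distribution) =
    density (\<Pi>\<^sub>M _\<in>UNIV. lborel) (\<lambda>z. \<Prod>p\<in>UNIV. ennreal (std_normal_density (z p)))"
proof (rule product_sigma_finite.PiM_eqI[symmetric])
  show "product_sigma_finite (\<lambda>_::'i. std_normal_distribution)"
    by (intro product_sigma_finite.intro prob_space_imp_sigma_finite prob_space_normal_density) simp
  interpret product_sigma_finite "\<lambda>_::'i. lborel :: real measure" ..
  show "sets (density (\<Pi>\<^sub>M _\<in>UNIV. lborel) (\<lambda>z. \<Prod>p\<in>UNIV. ennreal (std_normal_density (z p)))) =
    sets (\<Pi>\<^sub>M _\<in>(UNIV::'i set). std_normal_distribution)"
    by (simp cong: sets_PiM_cong)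
  fix A :: "'i \<Rightarrow> real set"
  assume A: "\<And>i. i \<in> UNIV \<Longrightarrow> A i \<in> sets std_normal_distribution"
  then have [measurable]: "A i \<in> sets borel" for i by simp
  have ind: "indicator (Pi\<^sub>E UNIV A) z = (\<Prod>p\<in>UNIV. indicator (A p) (z p) :: ennreal)" for z
    by (auto simp: indicator_def PiE_iff prod_zero_iff)
  have "emeasure (density (\<Pi>\<^sub>M _\<in>UNIV. lborel) (\<lambda>z. \<Prod>p\<in>UNIV. ennreal (std_normal_density (z p)))) (Pi\<^sub>E UNIV A)
     = (\<integral>\<^sup>+z. (\<Prod>p\<in>UNIV. ennreal (std_normal_density (z p)) * indicator (A p) (z p)) \<partial>(\<Pi>\<^sub>M _\<in>UNIV. lborel))"
    by (subst emeasure_density) (auto simp: ind prod.distrib intro!: sets_PiM_I_finite)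
  also have "\<dots> = (\<Prod>p\<in>UNIV. emeasure std_normal_distribution (A p))"
    by (subst product_nn_integral_prod) (auto simp: emeasure_density)
  finally show "emeasure (density (\<Pi>\<^sub>M _\<in>UNIV. lborel) (\<lambda>z. \<Prod>p\<in>UNIV. ennreal (std_normal_density (z p)))) (Pi\<^sub>E UNIV A)
     = (\<Prod>p\<in>UNIV. emeasure std_normal_distribution (A p))" .
qed simp

text \<open>The product of the one-dimensional densities depends on the entries only through the sum
  of their squares, the squared norm of the matrix. This form makes rotation invariance
  visible.\<close>

lemma distr_PiM_std_normal_matrix:
  "distr (\<Pi>\<^sub>M _\<in>UNIV. std_normal_distribution) borel (\<lambda>z. \<chi> i j. z (i, j)) = (gaussian :: (real^'n^'m) measure)"
proof -
  have eq: "(\<Prod>p\<in>UNIV. ennreal (std_normal_density (z p))) =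
    ennreal ((1 / sqrt (2 * pi)) ^ CARD('m \<times> 'n) * exp (- (norm (\<chi> i j. z (i, j) :: real^'n^'m))\<^sup>2 / 2))"
    for z :: "'m \<times> 'n \<Rightarrow> real"
    by (simp add: prod_ennreal std_normal_density_def norm_matrix_sqr prod.distrib
      sum_divide_distrib sum_negf del: prod_constant) (simp add: prod_constant power_one_over prod_dividef
      exp_sum[symmetric] sum_negf)
  show ?thesis
    unfolding PiM_std_normal gaussian_def distr_PiM_lborel_matrix[symmetric] eq
    by (subst density_distr) simp_all
qed

section \<open>Row-wise isometries and centering\<close>

definition map_rows :: "('a \<Rightarrow> 'b) \<Rightarrow> 'a^'m \<Rightarrow> 'b^'m" where
  "map_rows Q v = (\<chi> i. Q (v $ i))"

lemma map_rows_nth [simp]: "map_rows Q v $ i = Q (v $ i)"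
  by (simp add: map_rows_def)

lemma measurable_map_rows [measurable]:
  fixes Q :: "'a::euclidean_space \<Rightarrow> 'b::euclidean_space"
  assumes [measurable]: "Q \<in> borel_measurable borel"
  shows "map_rows Q \<in> borel_measurable (borel :: ('a^'m) measure)"
  unfolding map_rows_def[abs_def] by (rule measurable_vec_of_entries) measurable

lemma orthogonal_transformation_map_rows:
  fixes Q :: "'a::euclidean_space \<Rightarrow> 'a"
  assumes "orthogonal_transformation Q"
  shows "orthogonal_transformation (map_rows Q :: 'a^'m \<Rightarrow> 'a^'m)"
  using assms
  by (auto simp: orthogonal_transformation_def inner_vec_def linear_iff vec_eq_iff)

text \<open>\<open>map_rows Q\<close> is an isometry of the space of matrices, so it preserves both
  Lebesgue measure and the density, which is a function of the norm.\<close>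

lemma distr_gaussian_map_rows:
  fixes Q :: "real^'n \<Rightarrow> real^'n"
  assumes Q: "orthogonal_transformation Q"
  shows "distr gaussian borel (map_rows Q) = (gaussian :: (real^'n^'m) measure)"
proof -
  let ?Q = "map_rows Q :: real^'n^'m \<Rightarrow> real^'n^'m"
  have Q': "orthogonal_transformation ?Q"
    by (rule orthogonal_transformation_map_rows[OF Q])
  have [measurable]: "?Q \<in> borel_measurable borel"
    by (rule orthogonal_transformation_measurable[OF Q'])
  define \<phi> where "\<phi> = (\<lambda>v::real^'n^'m. ennreal ((1 / sqrt (2 * pi)) ^ CARD('m \<times> 'n) * exp (- (norm v)\<^sup>2 / 2)))"
  have [measurable]: "\<phi> \<in> borel_measurable borel" unfolding \<phi>_def by measurable
  have "gaussian = density (distr lborel borel ?Q) \<phi>"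
    by (simp add: gaussian_def \<phi>_def distr_lborel_orthogonal_transformation[OF Q'])
  also have "\<dots> = distr (density lborel (\<lambda>v. \<phi> (?Q v))) borel ?Q"
    by (simp add: density_distr)
  also have "(\<lambda>v. \<phi> (?Q v)) = \<phi>"
    using Q' by (simp add: \<phi>_def orthogonal_transformation_norm)
  finally show ?thesis by (simp add: gaussian_def \<phi>_def)
qed

text \<open>As \<open>1\<close> is the all-ones vector, this is the orthogonal projection onto the
  hyperplane of vectors with coordinate sum zero.\<close>

definition center :: "real^'n \<Rightarrow> real^'n" where
  "center v = v - ((v \<bullet> 1) / real CARD('n)) *\<^sub>R 1"

lemma mult_centering_matrix: "(M :: real^'n^'m) ** centering_matrix = map_rows center M"
proof -
  have "(\<Sum>k\<in>UNIV. M $ i $ k * (mat 1 :: real^'n^'n) $ k $ j) = M $ i $ j" for i j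
    using matrix_mul_rid[of M] by (simp add: vec_eq_iff matrix_matrix_mult_def)
  then show ?thesis
    by (simp add: vec_eq_iff matrix_matrix_mult_def centering_matrix_def center_def
        inner_vec_def right_diff_distrib sum_subtractf sum_divide_distrib[symmetric])
qed

lemma measurable_center [measurable]: "center \<in> borel_measurable borel"
  unfolding center_def[abs_def] by measurable

lemma rho_eq: "rho = distr gaussian borel (map_rows center :: real^'n^'m \<Rightarrow> real^'n^'m)"
  unfolding rho_def distr_PiM_std_normal_matrix[symmetric] mult_centering_matrix
  by (subst distr_distr) (simp_all add: comp_def)

lemma center_orthogonal_transformation:
  fixes Q :: "real^'n \<Rightarrow> real^'n"
  assumes "orthogonal_transformation Q" "Q 1 = 1"
  shows "center (Q v) = Q (center v)"
proof -
  have "Q v \<bullet> 1 = v \<bullet> 1"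
    using assms unfolding orthogonal_transformation_def by metis
  then show ?thesis
    using orthogonal_transformation_linear[OF assms(1)] assms(2)
    by (simp add: center_def linear_diff linear_scale)
qed

text \<open>An isometry fixing \<open>1\<close> commutes with the projection \<open>center\<close>,
  so the Gaussian invariance survives centering.\<close>

lemma distr_rho_map_rows:
  fixes Q :: "real^'n \<Rightarrow> real^'n"
  assumes Q: "orthogonal_transformation Q" "Q 1 = 1"
  shows "distr rho borel (map_rows Q) = (rho :: (real^'n^'m) measure)"
proof -
  have [measurable]: "Q \<in> borel_measurable borel"
    by (rule orthogonal_transformation_measurable[OF Q(1)])
  have "map_rows Q \<circ> map_rows center = map_rows center \<circ> (map_rows Q :: real^'n^'m \<Rightarrow> _)"
    by (simp add: fun_eq_iff vec_eq_iff center_orthogonal_transformation[OF Q])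
  then have "distr rho borel (map_rows Q) = distr (distr gaussian borel (map_rows Q)) borel (map_rows center :: real^'n^'m \<Rightarrow> _)"
    unfolding rho_eq by (simp add: distr_distr)
  then show ?thesis by (simp add: distr_gaussian_map_rows[OF Q(1)] rho_eq)
qed

lemma AE_rho_orthogonal_1: "AE X in (rho :: (real^'n^'m) measure). \<forall>i. X $ i \<bullet> 1 = 0"
proof -
  have "center v \<bullet> 1 = 0" for v :: "real^'n"
    by (simp add: center_def inner_diff_left inner_vec_def sum_subtractf)
  then show ?thesis
    unfolding rho_eq by (subst AE_distr_iff) simp_all
qed

section \<open>General position\<close>

text \<open>By the Leibniz formula the determinant along the line is a polynomial in
  \<open>t\<close>, and its value at \<open>0\<close> is non-zero.\<close>

lemma finite_singular_line:
  fixes A B :: "real^'q^'q"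
  assumes "det A \<noteq> 0"
  shows "finite {t. det (A + t *\<^sub>R B) = 0}"
proof -
  define P where "P = (\<Sum>p | p permutes UNIV. [:of_int (sign p):] * (\<Prod>i\<in>UNIV. [:A $ i $ p i, B $ i $ p i:]))"
  have P: "poly P t = det (A + t *\<^sub>R B)" for t
    by (simp add: P_def det_def poly_sum poly_prod)
  have "P \<noteq> 0"
    using assms P[of 0] by auto
  then have "finite {t. poly P t = 0}" by (rule poly_roots_finite)
  then show ?thesis by (simp add: P)
qed

text \<open>Every line through a point where the determinant is non-zero meets the singular set
  finitely often, so by Tonelli almost every dilate of that set about the point is null.\<close>

lemma AE_lborel_det_nonzero:
  fixes L :: "'a::euclidean_space \<Rightarrow> real^'q^'q"
  assumes L: "linear L" and z0: "det (C + L z0) \<noteq> 0"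
  shows "AE z in lborel. det (C + L z) \<noteq> 0"
proof -
  define F where "F = (\<lambda>z. det (C + L z))"
  have "continuous_on UNIV F"
    unfolding F_def det_def
    by (intro continuous_intros linear_continuous_on) (use L in \<open>simp add: linear_linear\<close>)
  then have [measurable]: "F \<in> borel_measurable borel"
    by (rule borel_measurable_continuous_onI)
  have "AE t in lborel. F (z0 + t *\<^sub>R x) \<noteq> 0" for x
  proof -
    have "F (z0 + t *\<^sub>R x) = det ((C + L z0) + t *\<^sub>R L x)" for t
      using L by (simp add: F_def linear_add linear_scale add.assoc)
    then have "finite {t. F (z0 + t *\<^sub>R x) = 0}"
      using finite_singular_line[OF z0, of "L x"] by simp
    then have "AE t in lborel. t \<notin> {t. F (z0 + t *\<^sub>R x) = 0}"
      by (intro AE_not_in finite_imp_null_set_lborel)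
    then show ?thesis by simp
  qed
  then have "AE x in lborel. AE t in lborel. F (z0 + t *\<^sub>R x) \<noteq> 0"
    by simp
  then have "AE t in lborel. AE x in lborel. F (z0 + t *\<^sub>R x) \<noteq> 0"
    by (subst (asm) lborel_pair.AE_commute) measurable
  \<comment> \<open>With a non-zero \<open>t\<close> the dilation about \<open>z0\<close> is
    invertible and carries the null set back to the singular set itself.\<close>
  moreover have "AE t in (lborel::real measure). t \<noteq> 0"
    using AE_not_in[OF finite_imp_null_set_lborel[of "{0::real}"]] by simp
  ultimately have "AE t in lborel. t \<noteq> 0 \<and> (AE x in lborel. F (z0 + t *\<^sub>R x) \<noteq> 0)"
    by eventually_elim simp
  from eventually_happens'[OF _ this] obtain t where t: "t \<noteq> 0" "AE x in lborel. F (z0 + t *\<^sub>R x) \<noteq> 0"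
    by (auto simp: ae_filter_eq_bot_iff)
  have "AE z in lborel. F z \<noteq> 0"
    by (subst lborel_affine[OF t(1), of z0]) (use t in \<open>simp add: AE_density AE_distr_iff\<close>)
  then show ?thesis by (simp add: F_def)
qed

lemma AE_gaussianI: "AE v in lborel. P v \<Longrightarrow> AE v in gaussian. P v"
  unfolding gaussian_def by (subst AE_density) auto

text \<open>The square submatrix of the Gale matrix of the columns of \<open>X\<close> on the
  columns selected by \<open>f\<close>. For injective \<open>f\<close> its invertibility means that
  the selected points are affinely independent.\<close>

definition minor :: "real^'n^'d \<Rightarrow> ('d option \<Rightarrow> 'n) \<Rightarrow> real^('d option)^('d option)" where
  "minor X f = (\<chi> r c. case r of None \<Rightarrow> 1 | Some i \<Rightarrow> X $ i $ f c)"

text \<open>The minor of the centered matrix is an affine function of the Gaussian one, so a single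
  invertible instance makes it invertible almost everywhere.\<close>

lemma AE_rho_minor:
  fixes f :: "'d::finite option \<Rightarrow> 'n::finite"
  assumes f: "inj f"
  shows "AE X in rho. det (minor X f) \<noteq> 0"
proof -
  \<comment> \<open>The row of ones makes \<open>minor\<close> affine; subtracting its value at
    \<open>0\<close> leaves the linear part.\<close>
  define L where "L = (\<lambda>v::real^'n^'d. minor (map_rows center v) f - minor 0 f)"
  have lin: "linear L"
    by (rule linearI) (auto simp: L_def minor_def vec_eq_iff center_def inner_add_left add_divide_distrib
        algebra_simps split: option.splits)
  \<comment> \<open>The selected columns become the origin, at \<open>f None\<close>, and the unit
    vectors: the vertices of a simplex.\<close>
  define v :: "real^'n^'d" where "v = (\<chi> i j. if j = f (Some i) then 1 else 0)"
  have ker: "c = 0" if c: "minor (map_rows center v) f *v c = 0" for c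
  proof -
    have sum0: "(\<Sum>a\<in>UNIV. c $ a) = 0"
      using c[unfolded vec_eq_iff, rule_format, of None] by (simp add: matrix_vector_mult_def minor_def)
    have some: "c $ Some i = 0" for i
    proof -
      have "0 = (\<Sum>a\<in>UNIV. center (v $ i) $ f a * c $ a)"
        using c[unfolded vec_eq_iff, rule_format, of "Some i"] by (simp add: matrix_vector_mult_def minor_def)
      \<comment> \<open>Centering subtracts a constant from each row. A kernel vector does not see
        it, because the row of ones forces its entries to sum to zero.\<close>
      also have "\<dots> = (\<Sum>a\<in>UNIV. v $ i $ f a * c $ a) - (v $ i \<bullet> 1) / CARD('n) * (\<Sum>a\<in>UNIV. c $ a)"
        by (simp add: center_def algebra_simps sum_subtractf sum_distrib_right sum_divide_distrib)
      also have "\<dots> = (\<Sum>a\<in>UNIV. if a = Some i then c $ a else 0)"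
        unfolding sum0 using inj_eq[OF f] by (simp add: v_def if_distrib[of "\<lambda>r. r * _"] cong: if_cong)
      finally show ?thesis by simp
    qed
    then have "c $ None = 0" using sum0 by (simp add: UNIV_option_conv sum.reindex)
    with some show "c = 0" unfolding vec_eq_iff by (metis not_None_eq zero_index)
  qed
  have "det (minor 0 f + L v) \<noteq> 0"
    using ker by (simp add: L_def invertible_det_nz[symmetric] invertible_left_inverse matrix_left_invertible_ker)
  from AE_lborel_det_nonzero[OF lin this]
  have ae: "AE v in lborel. det (minor (map_rows center v :: real^'n^'d) f) \<noteq> 0"
    by (simp add: L_def)
  have cont: "continuous_on UNIV (\<lambda>X::real^'n^'d. case r of None \<Rightarrow> 1 | Some i \<Rightarrow> X $ i $ f c)" for r c
    by (cases r) (auto intro!: continuous_intros)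
  have "continuous_on UNIV (\<lambda>X::real^'n^'d. det (minor X f))"
    unfolding det_def minor_def
    by (intro continuous_intros) (simp add: cont)
  then have [measurable]: "(\<lambda>X::real^'n^'d. det (minor X f)) \<in> borel_measurable borel"
    by (rule borel_measurable_continuous_onI)
  show ?thesis
    unfolding rho_eq using AE_gaussianI[OF ae] by (subst AE_distr_iff) simp_all
qed

text \<open>A kernel vector of the minor is the coefficient vector of an affine dependence among the
  selected points. Both halves of general position follow from there being only the zero
  one.\<close>

lemma general_position_if_minors:
  fixes X :: "real^'n^'d"
  assumes minors: "\<And>f. inj f \<Longrightarrow> det (minor X f) \<noteq> 0"
  shows "general_position (\<lambda>i. column i X)"
  unfolding general_position_def
proof (intro allI impI)
  fix S :: "'n set" assume S: "card S = CARD('d) + 1"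
  then have "card S = CARD('d option)" by (simp add: card_UNIV_option)
  moreover have "finite S" by simp
  ultimately obtain f :: "'d option \<Rightarrow> 'n" where f: "bij_betw f UNIV S"
    by (metis finite finite_same_card_bij)
  then have inj: "inj f" and S_eq: "S = range f" by (auto simp: bij_betw_def)
  have ker: "c = 0" if "minor X f *v c = 0" for c
    using minors[OF inj] that
    by (metis invertible_det_nz invertible_left_inverse matrix_left_invertible_ker)
  have indep: "c a = 0" if "(\<Sum>a\<in>UNIV. c a) = 0" "(\<Sum>a\<in>UNIV. c a *\<^sub>R column (f a) X) = 0" for c a
  proof -
    have "(\<Sum>a\<in>UNIV. X $ i $ f a * c a) = 0" for i
      using that(2) by (simp add: vec_eq_iff column_def mult.commute)
    then have "(\<Sum>a\<in>UNIV. (case r of None \<Rightarrow> 1 | Some i \<Rightarrow> X $ i $ f a) * c a) = 0" for r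
      using that(1) by (cases r) simp_all
    then have "minor X f *v (\<chi> a. c a) = 0"
      by (simp add: vec_eq_iff matrix_vector_mult_def minor_def)
    from ker[OF this] show ?thesis by (simp add: vec_eq_iff)
  qed
  have inj_cols: "inj_on (\<lambda>i. column i X) S"
  proof (rule inj_onI)
    fix p q assume "p \<in> S" "q \<in> S" and eq: "column p X = column q X"
    then obtain a b where ab: "p = f a" "q = f b" by (auto simp: S_eq)
    have "a = b"
    proof (rule ccontr)
      assume "a \<noteq> b"
      \<comment> \<open>Two equal columns would give the affine dependence with coefficients 1 and
        -1.\<close>
      define c where "c x = (if x = a then 1 else if x = b then -1 else 0 :: real)" for x
      have c: "c x = (if x = a then 1 else 0) - (if x = b then 1 else 0)" for x
        using \<open>a \<noteq> b\<close> by (simp add: c_def)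
      have "c a = 0"
      proof (rule indep)
        show "(\<Sum>a\<in>UNIV. c a) = 0" by (simp add: c sum_subtractf)
        have "c x *\<^sub>R column (f x) X = (if x = a then column p X else 0) - (if x = b then column q X else 0)" for x
          by (simp add: c ab)
        then show "(\<Sum>a\<in>UNIV. c a *\<^sub>R column (f a) X) = 0"
          using eq by (simp add: sum_subtractf)
      qed
      then show False by (simp add: c_def)
    qed
    then show "p = q" by (simp add: ab)
  qed
  moreover have "\<not> affine_dependent ((\<lambda>i. column i X) ` S)"
  proof
    assume "affine_dependent ((\<lambda>i. column i X) ` S)"
    then obtain U v where U: "sum U ((\<lambda>i. column i X) ` S) = 0" "v \<in> (\<lambda>i. column i X) ` S" "U v \<noteq> 0"
        "(\<Sum>v\<in>(\<lambda>i. column i X) ` S. U v *\<^sub>R v) = 0"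
      using affine_dependent_explicit_finite[of "(\<lambda>i. column i X) ` S"] by auto
    have inj': "inj (\<lambda>a. column (f a) X)"
      using inj_cols inj by (auto simp: S_eq inj_on_def)
    have img: "(\<lambda>i. column i X) ` S = range (\<lambda>a. column (f a) X)" by (auto simp: S_eq)
    from U(2) obtain a where a: "v = column (f a) X" by (auto simp: img)
    have "U (column (f a) X) = 0"
      using U(1,4) inj' by (intro indep[of "\<lambda>a. U (column (f a) X)"]) (simp_all add: img sum.reindex)
    with U(3) a show False by simp
  qed
  ultimately show "inj_on (\<lambda>i. column i X) S \<and> \<not> affine_dependent ((\<lambda>i. column i X) ` S)" ..
qed

text \<open>\<open>independent\<close> speaks of a set and would overlook a repeated vector; the
  condition on coefficients of the family excludes repetitions as well.\<close>

lemma independent_familyI: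
  fixes v :: "'m::finite \<Rightarrow> 'a::real_vector"
  assumes "\<And>c i. (\<Sum>i\<in>UNIV. c i *\<^sub>R v i) = 0 \<Longrightarrow> c i = 0"
  shows "inj v" and "independent (range v)"
proof -
  show inj: "inj v"
  proof (rule injI, rule ccontr)
    fix a b assume eq: "v a = v b" and "a \<noteq> b"
    define c where "c x = (if x = a then 1 else 0) - (if x = b then 1 else 0 :: real)" for x
    have "c x *\<^sub>R v x = (if x = a then v a else 0) - (if x = b then v b else 0)" for x
      by (simp add: c_def)
    then have "c a = 0"
      using eq by (intro assms) (simp add: sum_subtractf)
    with \<open>a \<noteq> b\<close> show False by (simp add: c_def)
  qed
  show "independent (range v)"
  proof (rule independent_if_scalars_zero)
    fix g x assume g: "(\<Sum>x\<in>range v. g x *\<^sub>R x) = 0" "x \<in> range v"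
    then have "(\<Sum>i\<in>UNIV. g (v i) *\<^sub>R v i) = 0" using inj by (simp add: sum.reindex)
    with assms[of "\<lambda>i. g (v i)"] g(2) show "g x = 0" by auto
  qed simp
qed

text \<open>A linear dependence of the rows, extended by the coefficient 0 for the row of ones, is a
  left kernel vector of the minor.\<close>

lemma rows_independent_if_minor:
  fixes X :: "real^'n^'d"
  assumes "det (minor X f) \<noteq> 0"
  shows "inj (($) X)" and "independent (range (($) X))"
proof -
  have "c i = 0" if c: "(\<Sum>i\<in>UNIV. c i *\<^sub>R X $ i) = 0" for c i
  proof -
    define w :: "real^('d option)" where "w = (\<chi> r. case r of None \<Rightarrow> 0 | Some i \<Rightarrow> c i)"
    have "(w v* minor X f) $ b = (\<Sum>i\<in>UNIV. c i *\<^sub>R X $ i) $ f b" for b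
      by (simp add: w_def vector_matrix_mult_def minor_def UNIV_option_conv sum.reindex mult.commute)
    then have "transpose (minor X f) *v w = 0"
      using c by (simp add: vec_eq_iff)
    then have "w = 0"
      using assms by (metis det_transpose invertible_det_nz invertible_left_inverse matrix_left_invertible_ker)
    then have "w $ Some i = 0" by simp
    then show ?thesis by (simp add: w_def)
  qed
  then show "inj (($) X)" "independent (range (($) X))"
    using independent_familyI[of "($) X"] by blast+
qed

lemma AE_rho_general_position:
  "AE X in (rho :: (real^'n^'d) measure). general_position (\<lambda>i. column i X)"
proof -
  have "AE X in (rho :: (real^'n^'d) measure). \<forall>f\<in>{f. inj f}. det (minor X f) \<noteq> 0"
    by (rule AE_finite_allI) (simp_all add: AE_rho_minor)
  then show ?thesis
    by eventually_elim (rule general_position_if_minors, simp)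
qed

text \<open>One minor suffices. It contains the row of ones besides the rows of \<open>X\<close>,
  hence the strict inequality.\<close>

lemma AE_rho_rows_independent:
  assumes "CARD('m) < CARD('n)"
  shows "AE X in (rho :: (real^'n^'m) measure). inj (($) X) \<and> independent (range (($) X))"
proof -
  have "card (UNIV :: 'm option set) \<le> card (UNIV :: 'n set)"
    using assms by (simp add: card_UNIV_option)
  then obtain f :: "'m option \<Rightarrow> 'n" where "inj f"
    by (metis card_le_inj finite top_greatest)
  from AE_rho_minor[OF this] show ?thesis
    by eventually_elim (simp add: rows_independent_if_minor)
qed

section \<open>Gram-Schmidt frames\<close>

lemma orthonormal_expansion_span:
  fixes u :: "'i::finite \<Rightarrow> 'a::real_inner"
  assumes u: "\<And>i j. u i \<bullet> u j = (if i = j then 1 else 0)" and v: "v \<in> span (range u)"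
  shows "v = (\<Sum>i\<in>UNIV. (v \<bullet> u i) *\<^sub>R u i)"
proof -
  have "span (range u) \<subseteq> {v. v = (\<Sum>i\<in>UNIV. (v \<bullet> u i) *\<^sub>R u i)}"
  proof (rule span_minimal)
    show "subspace {v. v = (\<Sum>i\<in>UNIV. (v \<bullet> u i) *\<^sub>R u i)}"
    proof (rule subspaceI)
      fix c v assume "v \<in> {v. v = (\<Sum>i\<in>UNIV. (v \<bullet> u i) *\<^sub>R u i)}"
      moreover have "(\<Sum>i\<in>UNIV. (c *\<^sub>R v \<bullet> u i) *\<^sub>R u i) = c *\<^sub>R (\<Sum>i\<in>UNIV. (v \<bullet> u i) *\<^sub>R u i)"
        by (simp add: scaleR_sum_right)
      ultimately show "c *\<^sub>R v \<in> {v. v = (\<Sum>i\<in>UNIV. (v \<bullet> u i) *\<^sub>R u i)}" by simp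
    qed (auto simp: inner_add_left scaleR_add_left sum.distrib)
    show "range u \<subseteq> {v. v = (\<Sum>i\<in>UNIV. (v \<bullet> u i) *\<^sub>R u i)}"
      by (auto simp: u if_distrib[of "\<lambda>c. c *\<^sub>R _"] cong: if_cong)
  qed
  with v show ?thesis by blast
qed

declare sum.cong [fundef_cong]

text \<open>The order of the Gram-Schmidt process on a finite index type is the one of an arbitrary
  enumeration; a vanishing residual stays \<open>0\<close> because \<open>sgn 0 = 0\<close>.\<close>

function gram_schmidt :: "('m::finite \<Rightarrow> 'a::real_inner) \<Rightarrow> 'm \<Rightarrow> 'a" where
  "gram_schmidt x i = sgn (x i - (\<Sum>j | to_nat j < to_nat i. (x i \<bullet> gram_schmidt x j) *\<^sub>R gram_schmidt x j))"
  by auto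
termination
  by (relation "Wellfounded.measure (\<lambda>(x, i). to_nat i)") auto

declare gram_schmidt.simps [simp del]

abbreviation residual :: "('m::finite \<Rightarrow> 'a::real_inner) \<Rightarrow> 'm \<Rightarrow> 'a" where
  "residual x i \<equiv> x i - (\<Sum>j | to_nat j < to_nat i. (x i \<bullet> gram_schmidt x j) *\<^sub>R gram_schmidt x j)"

lemma orthogonal_transformation_sgn:
  "orthogonal_transformation Q \<Longrightarrow> Q (sgn v) = sgn (Q v)"
  by (simp add: sgn_div_norm orthogonal_transformation_scaleR orthogonal_transformation_norm)

text \<open>The process uses only inner products, linear combinations and normalisation, all
  compatible with an isometry.\<close>

lemma gram_schmidt_orthogonal_transformation:
  assumes Q: "orthogonal_transformation Q"
  shows "gram_schmidt (\<lambda>i. Q (x i)) i = Q (gram_schmidt x i)"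
proof (induction "to_nat i" arbitrary: i rule: less_induct)
  case less
  have lin: "linear Q" using Q by (rule orthogonal_transformation_linear)
  have inner: "Q a \<bullet> Q b = a \<bullet> b" for a b
    using Q by (simp add: orthogonal_transformation_def)
  have "residual (\<lambda>i. Q (x i)) i = Q (residual x i)"
    by (simp add: linear_diff[OF lin] linear_sum[OF lin] linear_scale[OF lin] less inner)
  then show ?case
    by (simp add: gram_schmidt.simps[of _ i] orthogonal_transformation_sgn[OF Q])
qed

lemma measurable_gram_schmidt:
  fixes x :: "'w \<Rightarrow> 'm::finite \<Rightarrow> 'a::euclidean_space"
  assumes [measurable]: "\<And>i. (\<lambda>w. x w i) \<in> borel_measurable M"
  shows "(\<lambda>w. gram_schmidt (x w) i) \<in> borel_measurable M"
proof (induction "to_nat i" arbitrary: i rule: less_induct)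
  case less
  have [measurable]: "(\<lambda>w. gram_schmidt (x w) j) \<in> borel_measurable M" if "j \<in> {j. to_nat j < to_nat i}" for j
    using that less by simp
  show ?case
    by (subst gram_schmidt.simps) (unfold sgn_div_norm, measurable)
qed

text \<open>The index bound records that the frame vectors before \<open>i\<close> are built without
  \<open>x i\<close>; this is why the residuals of an independent family cannot vanish.\<close>

lemma gram_schmidt_in_span: "gram_schmidt x i \<in> span (x ` {j. to_nat j \<le> to_nat i})"
proof (induction "to_nat i" arbitrary: i rule: less_induct)
  case less
  have "gram_schmidt x j \<in> span (x ` {j. to_nat j \<le> to_nat i})" if "to_nat j < to_nat i" for j
    using less[OF that] span_mono[of "x ` {k. to_nat k \<le> to_nat j}" "x ` {k. to_nat k \<le> to_nat i}"] that by fastforce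
  then show ?case
    by (subst gram_schmidt.simps, unfold sgn_div_norm) (auto intro!: span_scale span_diff span_sum intro: span_base)
qed

lemma gram_schmidt_orthogonal:
  assumes "\<And>i. x i \<bullet> v = 0"
  shows "gram_schmidt x i \<bullet> v = 0"
proof -
  have "span (x ` {j. to_nat j \<le> to_nat i}) \<subseteq> {u. u \<bullet> v = 0}"
    using assms by (intro span_minimal) (auto simp: subspace_def inner_add_left)
  with gram_schmidt_in_span[of x i] show ?thesis by blast
qed

context
  fixes x :: "'m::finite \<Rightarrow> 'a::real_inner"
  assumes inj: "inj x" and indep: "independent (range x)"
begin

lemma residual_nonzero: "residual x i \<noteq> 0"
proof
  assume "residual x i = 0"
  then have "x i = (\<Sum>j | to_nat j < to_nat i. (x i \<bullet> gram_schmidt x j) *\<^sub>R gram_schmidt x j)" by simp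
  moreover have "gram_schmidt x j \<in> span (range x - {x i})" if "to_nat j < to_nat i" for j
  proof -
    have "x ` {k. to_nat k \<le> to_nat j} \<subseteq> range x - {x i}"
      using that inj by (auto dest: injD)
    then show ?thesis using gram_schmidt_in_span[of x j] span_mono by blast
  qed
  ultimately have "x i \<in> span (range x - {x i})"
    by (metis (no_types, lifting) mem_Collect_eq span_scale span_sum)
  with indep show False by (auto simp: dependent_def)
qed

text \<open>The induction is on a common bound for both indices, so that the hypothesis covers all
  pairs of earlier frame vectors at once.\<close>

lemma gram_schmidt_orthonormal_upto:
  "to_nat a \<le> N \<Longrightarrow> to_nat b \<le> N \<Longrightarrow> gram_schmidt x a \<bullet> gram_schmidt x b = (if a = b then 1 else 0)"
proof (induction N arbitrary: a b rule: less_induct)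
  case (less N)
  have unit: "gram_schmidt x i \<bullet> gram_schmidt x i = 1" for i
  proof -
    have "norm (gram_schmidt x i) = 1"
      using residual_nonzero[of i] by (subst gram_schmidt.simps) (simp add: norm_sgn)
    then show ?thesis by (simp add: norm_eq_1)
  qed
  have orth: "gram_schmidt x i \<bullet> gram_schmidt x k = 0" if "to_nat k < to_nat i" "to_nat i \<le> N" for i k
  proof -
    have IH: "gram_schmidt x j \<bullet> gram_schmidt x k = (if j = k then 1 else 0)" if "to_nat j < to_nat i" for j
      using less.IH[of "max (to_nat j) (to_nat k)" j k] that \<open>to_nat k < to_nat i\<close> \<open>to_nat i \<le> N\<close> by simp
    \<comment> \<open>The earlier vectors are orthonormal, so only the term at \<open>k\<close>
      survives, and it is the component of \<open>x i\<close> that the residual removes.\<close>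
    have "(\<Sum>j | to_nat j < to_nat i. (x i \<bullet> gram_schmidt x j) * (gram_schmidt x j \<bullet> gram_schmidt x k))
        = (\<Sum>j | to_nat j < to_nat i. if j = k then x i \<bullet> gram_schmidt x k else 0)"
      by (rule sum.cong) (auto simp: IH)
    also have "\<dots> = x i \<bullet> gram_schmidt x k"
      using that by (simp add: sum.delta)
    finally have "residual x i \<bullet> gram_schmidt x k = 0"
      by (simp add: inner_diff_left inner_sum_left)
    then show ?thesis by (subst (1) gram_schmidt.simps) (simp add: sgn_div_norm)
  qed
  show ?case
    using orth[of a b] orth[of b a] less.prems unit
    by (metis inner_commute linorder_neqE_nat to_nat_split)
qed

lemma gram_schmidt_orthonormal:
  "gram_schmidt x a \<bullet> gram_schmidt x b = (if a = b then 1 else 0)"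
  using gram_schmidt_orthonormal_upto[of a "max (to_nat a) (to_nat b)" b] by simp

lemma gram_schmidt_expansion:
  "x i = (\<Sum>j\<in>UNIV. (x i \<bullet> gram_schmidt x j) *\<^sub>R gram_schmidt x j)"
proof -
  let ?k = "gram_schmidt x"
  have "residual x i = norm (residual x i) *\<^sub>R ?k i"
    using residual_nonzero[of i] by (subst gram_schmidt.simps) (simp add: sgn_div_norm)
  then have "x i = (\<Sum>j | to_nat j < to_nat i. (x i \<bullet> ?k j) *\<^sub>R ?k j) + norm (residual x i) *\<^sub>R ?k i"
    by (simp add: algebra_simps)
  then have "x i \<in> span (range ?k)"
    by (metis (no_types, lifting) rangeI span_add span_base span_scale span_sum)
  then show ?thesis
    by (intro orthonormal_expansion_span gram_schmidt_orthonormal)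
qed

end

section \<open>Transporting one orthonormal family to another\<close>

lemma orthogonal_transformation_reflection:
  fixes a :: "'a::real_inner"
  shows "orthogonal_transformation (\<lambda>v. v - (2 * (v \<bullet> a) / (a \<bullet> a)) *\<^sub>R a)"
proof (cases "a = 0")
  case False
  then have "a \<bullet> a \<noteq> 0" by simp
  then have "(v - (2 * (v \<bullet> a) / (a \<bullet> a)) *\<^sub>R a) \<bullet> (w - (2 * (w \<bullet> a) / (a \<bullet> a)) *\<^sub>R a) = v \<bullet> w" for v w
    using inner_commute[of a w] by (simp add: inner_diff_left inner_diff_right field_simps)
  moreover have "linear (\<lambda>v. v - (2 * (v \<bullet> a) / (a \<bullet> a)) *\<^sub>R a)"
    by (rule linearI) (simp_all add: inner_add_left add_divide_distrib algebra_simps)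
  ultimately show ?thesis by (simp add: orthogonal_transformation_def)
qed simp

text \<open>The families are matched one vector at a time, each time composing with a Householder
  reflection. They may span less than the whole space, on which \<open>Q\<close> is nevertheless an
  isometry.\<close>

lemma orthonormal_families_related:
  fixes u e :: "'m \<Rightarrow> 'a::euclidean_space"
  assumes S: "finite S"
    and u: "\<And>i j. i \<in> S \<Longrightarrow> j \<in> S \<Longrightarrow> u i \<bullet> u j = (if i = j then 1 else 0)"
    and e: "\<And>i j. i \<in> S \<Longrightarrow> j \<in> S \<Longrightarrow> e i \<bullet> e j = (if i = j then 1 else 0)"
  obtains Q where "orthogonal_transformation Q" "\<And>i. i \<in> S \<Longrightarrow> Q (u i) = e i"
proof -
  have "\<exists>Q. orthogonal_transformation Q \<and> (\<forall>i\<in>S. Q (u i) = e i)"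
    using assms
  proof (induction S rule: finite_induct)
    case empty
    show ?case using orthogonal_transformation_id by blast
  next
    case (insert k S)
    then obtain Q where Q: "orthogonal_transformation Q" "\<And>i. i \<in> S \<Longrightarrow> Q (u i) = e i"
      by auto
    have inner: "Q a \<bullet> Q b = a \<bullet> b" for a b
      using Q(1) by (simp add: orthogonal_transformation_def)
    define a where "a = Q (u k) - e k"
    \<comment> \<open>the reflection exchanging \<open>Q (u k)\<close> and \<open>e k\<close> fixes the vectors already matched\<close>
    define R where "R v = v - (2 * (v \<bullet> a) / (a \<bullet> a)) *\<^sub>R a" for v
    have R: "orthogonal_transformation R"
      unfolding R_def[abs_def] by (rule orthogonal_transformation_reflection)
    have fix_S: "R (e i) = e i" if "i \<in> S" for i
    proof -
      have "e i \<bullet> Q (u k) = u i \<bullet> u k" using Q(2)[OF that] inner by metis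
      then have "e i \<bullet> a = 0"
        using insert.hyps that by (auto simp: a_def inner_diff_right insert.prems)
      then show ?thesis by (simp add: R_def)
    qed
    have "R (Q (u k)) = e k"
    proof (cases "a = 0")
      case True
      then show ?thesis by (simp add: R_def a_def)
    next
      case False
      \<comment> \<open>Since \<open>Q (u k)\<close> and \<open>e k\<close> are both unit vectors,
        the reflection subtracts exactly \<open>a\<close> from \<open>Q (u k)\<close>.\<close>
      have "2 * (Q (u k) \<bullet> a) = a \<bullet> a"
        using inner_commute[of "e k" "Q (u k)"]
        by (simp add: a_def inner_diff_left inner_diff_right inner insert.prems)
      then show ?thesis using False by (simp add: R_def) (simp add: a_def)
    qed
    then have "\<forall>i\<in>insert k S. (R \<circ> Q) (u i) = e i"
      using Q(2) fix_S by auto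
    then show ?case using orthogonal_transformation_compose[OF R Q(1)] by blast
  qed
  then show thesis using that by blast
qed

section \<open>Random isometries of the hyperplane\<close>

lemma orthonormal_expansion:
  fixes u :: "'i::finite \<Rightarrow> 'a::euclidean_space"
  assumes u: "\<And>i j. u i \<bullet> u j = (if i = j then 1 else 0)" and card: "CARD('i) = DIM('a)"
  shows "v = (\<Sum>i\<in>UNIV. (v \<bullet> u i) *\<^sub>R u i)"
proof -
  have "c i = 0" if "(\<Sum>i\<in>UNIV. c i *\<^sub>R u i) = 0" for c i
  proof -
    have "0 = (\<Sum>j\<in>UNIV. c j *\<^sub>R u j) \<bullet> u i" using that by simp
    also have "\<dots> = c i"
      by (simp add: inner_sum_left u if_distrib[of "\<lambda>r. _ * r"] cong: if_cong)
    finally show ?thesis by simp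
  qed
  then have inj: "inj u" and "independent (range u)"
    using independent_familyI[of u] by blast+
  then have "UNIV \<subseteq> span (range u)"
    by (intro card_ge_dim_independent) (simp_all add: card_image card)
  then show ?thesis by (intro orthonormal_expansion_span u) blast
qed

text \<open>The event, almost sure for fewer rows than columns, on which Gram-Schmidt yields an
  orthonormal frame inside the hyperplane orthogonal to \<open>1\<close>.\<close>

definition centered_rows :: "real^'n^'m \<Rightarrow> bool" where
  "centered_rows X \<longleftrightarrow> (\<forall>i. X $ i \<bullet> 1 = 0) \<and> inj (($) X) \<and> independent (range (($) X))"

lemma AE_rho_centered_rows:
  assumes "CARD('m) < CARD('n)"
  shows "AE X in (rho :: (real^'n^'m) measure). centered_rows X"
  using AE_rho_orthogonal_1 AE_rho_rows_independent[OF assms]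
  by eventually_elim (simp add: centered_rows_def)

text \<open>The normalised vector \<open>1\<close> is adjoined to both families at the index
  \<open>None\<close>, so that the isometry matching them also fixes \<open>1\<close>.\<close>

lemma centered_orthonormal_related:
  fixes u e :: "'m::finite \<Rightarrow> real^'n"
  assumes u: "\<And>i j. u i \<bullet> u j = (if i = j then 1 else 0)" "\<And>i. u i \<bullet> 1 = 0"
    and e: "\<And>i j. e i \<bullet> e j = (if i = j then 1 else 0)" "\<And>i. e i \<bullet> 1 = 0"
  obtains Q where "orthogonal_transformation Q" "Q 1 = 1" "\<And>i. Q (u i) = e i"
proof -
  define c :: "real^'n" where "c = (1 / sqrt (real CARD('n))) *\<^sub>R 1"
  have one: "1 \<bullet> (1::real^'n) = CARD('n)" by (simp add: inner_vec_def)
  have c: "c \<bullet> c = 1" by (simp add: c_def one)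
  have cu: "c \<bullet> u i = 0" "u i \<bullet> c = 0" "c \<bullet> e i = 0" "e i \<bullet> c = 0" for i
    using u(2)[of i] e(2)[of i] by (simp_all add: c_def inner_commute)
  obtain Q where Q: "orthogonal_transformation Q"
      "\<And>p. p \<in> (UNIV :: 'm option set) \<Longrightarrow> Q (case p of None \<Rightarrow> c | Some i \<Rightarrow> u i) = (case p of None \<Rightarrow> c | Some i \<Rightarrow> e i)"
    by (rule orthonormal_families_related[of "UNIV :: 'm option set" "case_option c u" "case_option c e"])
      (auto simp: u e c cu split: option.splits)
  have "1 = sqrt (real CARD('n)) *\<^sub>R c" by (simp add: c_def)
  moreover have "Q c = c" using Q(2)[of None] by simp
  ultimately have "Q 1 = 1"
    by (metis Q(1) orthogonal_transformation_scaleR)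
  moreover have "Q (u i) = e i" for i using Q(2)[of "Some i"] by simp
  ultimately show thesis using that Q(1) by blast
qed

text \<open>On the hyperplane orthogonal to \<open>1\<close>, \<open>rotation e w\<close> is the isometry taking the Gram-Schmidt
  frame of the rows of \<open>w\<close> to the frame \<open>e\<close>; for \<open>w\<close> distributed as \<open>rho\<close> it is Haar distributed.\<close>

definition rotation :: "('q::finite \<Rightarrow> real^'n) \<Rightarrow> real^'n^'q \<Rightarrow> real^'n \<Rightarrow> real^'n" where
  "rotation e w v = (\<Sum>l\<in>UNIV. (gram_schmidt (($) w) l \<bullet> v) *\<^sub>R e l)"

text \<open>Replaces the Gram-Schmidt frame of the rows of \<open>x\<close> by part of the frame \<open>e\<close>, keeping the Gram matrix.\<close>

definition reframe :: "('m::finite \<Rightarrow> real^'n) \<Rightarrow> real^'n^'m \<Rightarrow> real^'n^'m" where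
  "reframe e x = map_rows (\<lambda>v. \<Sum>j\<in>UNIV. (v \<bullet> gram_schmidt (($) x) j) *\<^sub>R e j) x"

lemma measurable_rotation [measurable]:
  fixes e :: "'q::finite \<Rightarrow> real^'n"
  assumes [measurable]: "w \<in> borel_measurable M" "v \<in> borel_measurable M"
  shows "(\<lambda>p. rotation e (w p) (v p)) \<in> borel_measurable M"
proof -
  have [measurable]: "(\<lambda>p. gram_schmidt (($) (w p)) l) \<in> borel_measurable M" for l
    by (rule measurable_gram_schmidt) measurable
  show ?thesis unfolding rotation_def by measurable
qed

lemma measurable_map_rows_rotation [measurable]:
  fixes e :: "'q::finite \<Rightarrow> real^'n" and x :: "'w \<Rightarrow> real^'n^'m"
  assumes [measurable]: "w \<in> borel_measurable M" "x \<in> borel_measurable M"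
  shows "(\<lambda>p. map_rows (rotation e (w p)) (x p)) \<in> borel_measurable M"
  unfolding map_rows_def by (rule measurable_vec_of_entries) measurable

lemma measurable_reframe [measurable]:
  fixes e :: "'m::finite \<Rightarrow> real^'n"
  shows "reframe e \<in> borel_measurable borel"
proof -
  have [measurable]: "(\<lambda>x::real^'n^'m. gram_schmidt (($) x) j) \<in> borel_measurable borel" for j
    by (rule measurable_gram_schmidt) measurable
  show ?thesis
    unfolding reframe_def[abs_def] map_rows_def by (rule measurable_vec_of_entries) measurable
qed

context
  fixes e :: "'q::finite \<Rightarrow> real^'n"
  assumes e: "\<And>i j. e i \<bullet> e j = (if i = j then 1 else 0)" "\<And>i. e i \<bullet> 1 = 0"
    and card: "CARD('n) = CARD('q) + 1"
begin

text \<open>\<open>rotation e w\<close> annihilates \<open>1\<close> and is an isometry only on the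
  hyperplane; \<open>Q\<close> extends it from there to the whole space.\<close>

lemma rotation_orthogonal:
  assumes w: "centered_rows w"
  obtains Q where "orthogonal_transformation Q" "Q 1 = 1" "\<And>v. v \<bullet> 1 = 0 \<Longrightarrow> rotation e w v = Q v"
proof -
  define k where "k = gram_schmidt (($) w)"
  have k: "k i \<bullet> k j = (if i = j then 1 else 0)" "k i \<bullet> 1 = 0" for i j
    using w unfolding k_def centered_rows_def
    by (auto intro!: gram_schmidt_orthogonal simp: gram_schmidt_orthonormal)
  obtain Q where Q: "orthogonal_transformation Q" "Q 1 = 1" "\<And>i. Q (k i) = e i"
    by (rule centered_orthonormal_related[of k e]) (auto simp: k e)
  have "rotation e w v = Q v" if v: "v \<bullet> 1 = 0" for v
  proof -
    define c :: "real^'n" where "c = (1 / sqrt (real CARD('n))) *\<^sub>R 1"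
    have one: "1 \<bullet> (1::real^'n) = CARD('n)" by (simp add: inner_vec_def)
    have c: "c \<bullet> c = 1" "c \<bullet> k i = 0" "k i \<bullet> c = 0" "v \<bullet> c = 0" for i
      using k(2)[of i] v by (simp_all add: c_def one inner_commute)
    \<comment> \<open>By the cardinality assumption the frame and \<open>c\<close> together form an
      orthonormal basis, and the coefficient of \<open>v\<close> at \<open>c\<close> is
      zero.\<close>
    have "v = (\<Sum>p\<in>UNIV. (v \<bullet> case_option c k p) *\<^sub>R case_option c k p)"
      by (rule orthonormal_expansion) (auto simp: k c card card_UNIV_option split: option.splits)
    then have "v = (\<Sum>l\<in>UNIV. (v \<bullet> k l) *\<^sub>R k l)"
      by (simp add: UNIV_option_conv sum.reindex c)
    then have "Q v = (\<Sum>l\<in>UNIV. (v \<bullet> k l) *\<^sub>R e l)"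
      using orthogonal_transformation_linear[OF Q(1)] Q(3)
      by (metis (no_types, lifting) linear_scale linear_sum sum.cong)
    then show ?thesis by (simp add: rotation_def k_def inner_commute)
  qed
  then show thesis using that Q by blast
qed

text \<open>Moves a fixed isometry from the argument onto the sample \<open>w\<close>, where the
  invariance of its distribution can absorb it.\<close>

lemma rotation_comp:
  assumes Q: "orthogonal_transformation Q"
  shows "rotation e w (Q v) = rotation e (map_rows (inv Q) w) v"
proof -
  have inv: "orthogonal_transformation (inv Q)" "inv Q (Q v) = v"
    using Q by (auto intro: orthogonal_transformation_inv simp: orthogonal_transformation_inj)
  have "inv Q a \<bullet> inv Q (Q v) = a \<bullet> Q v" for a
    using inv(1) by (simp add: orthogonal_transformation_def)
  then have "a \<bullet> Q v = inv Q a \<bullet> v" for a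
    by (simp add: inv(2))
  moreover have "gram_schmidt (($) (map_rows (inv Q) w)) = (\<lambda>l. inv Q (gram_schmidt (($) w) l))"
  proof -
    have "($) (map_rows (inv Q) w) = (\<lambda>l. inv Q (w $ l))" by auto
    then show ?thesis
      using gram_schmidt_orthogonal_transformation[OF inv(1), of "($) w"] by auto
  qed
  ultimately show ?thesis by (simp add: rotation_def)
qed

text \<open>Each row is expanded in the Gram-Schmidt frame of \<open>x\<close>, and an isometry
  carries that frame to the chosen part of \<open>e\<close>. This isometry depends on
  \<open>x\<close>.\<close>

lemma reframe_orthogonal:
  fixes x :: "real^'n^'m" and \<iota> :: "'m \<Rightarrow> 'q"
  assumes x: "centered_rows x" and \<iota>: "inj \<iota>"
  obtains Q where "orthogonal_transformation Q" "Q 1 = 1" "reframe (e \<circ> \<iota>) x = map_rows Q x"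
proof -
  define k where "k = gram_schmidt (($) x)"
  have k: "k i \<bullet> k j = (if i = j then 1 else 0)" "k i \<bullet> 1 = 0" for i j
    using x unfolding k_def centered_rows_def
    by (auto intro!: gram_schmidt_orthogonal simp: gram_schmidt_orthonormal)
  obtain Q where Q: "orthogonal_transformation Q" "Q 1 = 1" "\<And>i. Q (k i) = e (\<iota> i)"
    by (rule centered_orthonormal_related[of k "e \<circ> \<iota>"]) (auto simp: k e inj_eq[OF \<iota>])
  have "Q (x $ i) = (\<Sum>j\<in>UNIV. (x $ i \<bullet> k j) *\<^sub>R e (\<iota> j))" for i
  proof -
    have "x $ i = (\<Sum>j\<in>UNIV. (x $ i \<bullet> k j) *\<^sub>R k j)"
      unfolding k_def by (rule gram_schmidt_expansion) (use x in \<open>auto simp: centered_rows_def\<close>)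
    then have "Q (x $ i) = Q (\<Sum>j\<in>UNIV. (x $ i \<bullet> k j) *\<^sub>R k j)" by simp
    then show ?thesis
      using orthogonal_transformation_linear[OF Q(1)] Q(3) by (simp add: linear_sum linear_scale)
  qed
  then have "reframe (e \<circ> \<iota>) x = map_rows Q x"
    by (simp add: reframe_def k_def vec_eq_iff)
  then show thesis using that Q by blast
qed

text \<open>The sample \<open>x\<close> lives on an arbitrary space \<open>M\<close> so that the
  result applies to either component of a product.\<close>

lemma distr_rotated:
  fixes M :: "'w measure" and x :: "'w \<Rightarrow> real^'n^'m" and \<iota> :: "'m \<Rightarrow> 'q"
  assumes M: "prob_space M" and x [measurable]: "x \<in> borel_measurable M" and dx: "distr M borel x = rho"
    and \<iota>: "inj \<iota>"
  shows "distr (M \<Otimes>\<^sub>M rho) borel (\<lambda>p. map_rows (rotation e (snd p)) (reframe (e \<circ> \<iota>) (x (fst p)))) = rho"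
    (is "distr _ _ ?F = _")
proof (rule measure_eqI)
  interpret M: prob_space M by (rule M)
  interpret R: prob_space "rho :: (real^'n^'q) measure" by (rule prob_space_rho)
  interpret MR: pair_prob_space M "rho :: (real^'n^'q) measure" ..
  have card_m: "CARD('m) < CARD('n)"
    using card_inj_on_le[OF \<iota>, of UNIV] card by simp
  have [measurable]: "?F \<in> borel_measurable (M \<Otimes>\<^sub>M rho)" by measurable
  fix A assume "A \<in> sets (distr (M \<Otimes>\<^sub>M rho) borel ?F)"
  then have A [measurable]: "A \<in> sets borel" by simp
  have "emeasure (distr (M \<Otimes>\<^sub>M rho) borel ?F) A = (\<integral>\<^sup>+p. indicator A (?F p) \<partial>(M \<Otimes>\<^sub>M rho))"
    by (subst nn_integral_indicator[symmetric], simp, subst nn_integral_distr) simp_all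
  also have "\<dots> = (\<integral>\<^sup>+\<omega>. \<integral>\<^sup>+w. indicator A (?F (\<omega>, w)) \<partial>rho \<partial>M)"
    by (rule R.nn_integral_fst[symmetric]) measurable
  \<comment> \<open>For fixed \<open>\<omega>\<close> reframing is a fixed isometry, which
    disappears into the distribution of \<open>w\<close>.\<close>
  also have "\<dots> = (\<integral>\<^sup>+\<omega>. \<integral>\<^sup>+w. indicator A (map_rows (rotation e w) (x \<omega>)) \<partial>rho \<partial>M)"
  proof (rule nn_integral_cong_AE)
    have "AE \<omega> in M. centered_rows (x \<omega>)"
      using AE_distrD[OF x] AE_rho_centered_rows[OF card_m] dx by metis
    then show "AE \<omega> in M. (\<integral>\<^sup>+w. indicator A (?F (\<omega>, w)) \<partial>rho) = (\<integral>\<^sup>+w. indicator A (map_rows (rotation e w) (x \<omega>)) \<partial>rho)"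
    proof eventually_elim
      fix \<omega> assume "centered_rows (x \<omega>)"
      then obtain Q where Q: "orthogonal_transformation Q" "Q 1 = 1" "reframe (e \<circ> \<iota>) (x \<omega>) = map_rows Q (x \<omega>)"
        using reframe_orthogonal \<iota> by metis
      have inv: "orthogonal_transformation (inv Q)" "inv Q 1 = 1"
        using Q by (auto intro: orthogonal_transformation_inv inv_f_eq simp: orthogonal_transformation_inj)
      have [measurable]: "inv Q \<in> borel_measurable borel"
        by (rule orthogonal_transformation_measurable[OF inv(1)])
      have "(\<integral>\<^sup>+w. indicator A (?F (\<omega>, w)) \<partial>rho) =
          (\<integral>\<^sup>+w. indicator A (map_rows (rotation e (map_rows (inv Q) w)) (x \<omega>)) \<partial>rho)"
        by (simp add: Q(3) map_rows_def rotation_comp[OF Q(1)])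
      also have "\<dots> = (\<integral>\<^sup>+w. indicator A (map_rows (rotation e w) (x \<omega>)) \<partial>distr rho borel (map_rows (inv Q)))"
        by (subst nn_integral_distr) simp_all
      also have "distr rho borel (map_rows (inv Q)) = (rho :: (real^'n^'q) measure)"
        by (rule distr_rho_map_rows[OF inv])
      finally show "(\<integral>\<^sup>+w. indicator A (?F (\<omega>, w)) \<partial>rho) = (\<integral>\<^sup>+w. indicator A (map_rows (rotation e w) (x \<omega>)) \<partial>rho)" .
    qed
  qed
  \<comment> \<open>With the order exchanged \<open>w\<close> is fixed, and the rotation acts as a
    fixed isometry on almost every value of \<open>x\<close>.\<close>
  also have "\<dots> = (\<integral>\<^sup>+w. \<integral>\<^sup>+\<omega>. indicator A (map_rows (rotation e w) (x \<omega>)) \<partial>M \<partial>rho)"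
    by (rule MR.Fubini'[symmetric]) measurable
  also have "\<dots> = (\<integral>\<^sup>+w. emeasure (rho :: (real^'n^'m) measure) A \<partial>(rho :: (real^'n^'q) measure))"
  proof (rule nn_integral_cong_AE)
    have "CARD('q) < CARD('n)" using card by simp
    from AE_rho_centered_rows[OF this]
    show "AE w in (rho :: (real^'n^'q) measure). (\<integral>\<^sup>+\<omega>. indicator A (map_rows (rotation e w) (x \<omega>)) \<partial>M) = emeasure (rho :: (real^'n^'m) measure) A"
    proof eventually_elim
      fix w :: "real^'n^'q" assume "centered_rows w"
      then obtain Q where Q: "orthogonal_transformation Q" "Q 1 = 1" "\<And>v. v \<bullet> 1 = 0 \<Longrightarrow> rotation e w v = Q v"
        using rotation_orthogonal by metis
      have [measurable]: "Q \<in> borel_measurable borel"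
        by (rule orthogonal_transformation_measurable[OF Q(1)])
      have "(\<integral>\<^sup>+\<omega>. indicator A (map_rows (rotation e w) (x \<omega>)) \<partial>M) = (\<integral>\<^sup>+X. indicator A (map_rows (rotation e w) X) \<partial>(rho :: (real^'n^'m) measure))"
        unfolding dx[symmetric] by (subst nn_integral_distr) simp_all
      also have "\<dots> = (\<integral>\<^sup>+X. indicator A (map_rows Q X) \<partial>(rho :: (real^'n^'m) measure))"
      proof (rule nn_integral_cong_AE)
        show "AE X in (rho :: (real^'n^'m) measure). (indicator A (map_rows (rotation e w) X) :: ennreal) = indicator A (map_rows Q X)"
          using AE_rho_orthogonal_1 by eventually_elim (simp add: map_rows_def Q(3))
      qed
      also have "\<dots> = (\<integral>\<^sup>+X. indicator A X \<partial>distr (rho :: (real^'n^'m) measure) borel (map_rows Q))"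
        by (subst nn_integral_distr) simp_all
      also have "\<dots> = emeasure (rho :: (real^'n^'m) measure) A"
        by (simp add: distr_rho_map_rows[OF Q(1,2)])
      finally show "(\<integral>\<^sup>+\<omega>. indicator A (map_rows (rotation e w) (x \<omega>)) \<partial>M) = emeasure (rho :: (real^'n^'m) measure) A" .
    qed
  qed
  also have "\<dots> = emeasure (rho :: (real^'n^'m) measure) A"
    by (simp add: R.emeasure_space_1)
  finally show "emeasure (distr (M \<Otimes>\<^sub>M rho) borel ?F) A = emeasure rho A" .
qed simp

end

section \<open>Gale duality\<close>

text \<open>Lets Gale duality hold at every point of the final space instead of almost everywhere,
  with the marginals unchanged.\<close>

lemma distr_restrict_conull:
  assumes N: "N \<in> null_sets M" and f [measurable]: "f \<in> measurable M M'"
  shows "distr (restrict_space M (space M - N)) M' f = distr M M' f"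
proof (rule measure_eqI)
  have [measurable]: "N \<in> sets M" using N by auto
  have fr: "f \<in> measurable (restrict_space M (space M - N)) M'"
    by (rule measurable_restrict_space1[OF f])
  fix A assume "A \<in> sets (distr (restrict_space M (space M - N)) M' f)"
  then have A [measurable]: "A \<in> sets M'" by simp
  have "emeasure (distr (restrict_space M (space M - N)) M' f) A = emeasure M (f -` A \<inter> (space M - N))"
    by (subst emeasure_distr[OF fr A], subst emeasure_restrict_space)
      (auto simp: space_restrict_space intro!: arg_cong2[where f=emeasure])
  also have "\<dots> = emeasure M (f -` A \<inter> space M)"
  proof (rule emeasure_eq_AE)
    have "f -` A \<inter> (space M - N) = (f -` A \<inter> space M) - N" by auto
    then show "f -` A \<inter> (space M - N) \<in> sets M" by simp
    show "AE x in M. x \<in> f -` A \<inter> (space M - N) \<longleftrightarrow> x \<in> f -` A \<inter> space M"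
      using AE_not_in[OF N] by eventually_elim auto
  qed simp
  finally show "emeasure (distr (restrict_space M (space M - N)) M' f) A = emeasure (distr M M' f) A"
    by (simp add: emeasure_distr)
qed simp

lemma distr_pair_snd:
  assumes "prob_space M" "prob_space N"
  shows "distr (M \<Otimes>\<^sub>M N) N snd = N"
proof (rule measure_eqI)
  interpret M: prob_space M by fact
  interpret N: prob_space N by fact
  fix A assume "A \<in> sets (distr (M \<Otimes>\<^sub>M N) N snd)"
  then have A: "A \<in> sets N" by simp
  then have "snd -` A \<inter> space (M \<Otimes>\<^sub>M N) = space M \<times> A"
    using sets.sets_into_space by (auto simp: space_pair_measure)
  with A show "emeasure (distr (M \<Otimes>\<^sub>M N) N snd) A = emeasure N A"
    by (simp add: emeasure_distr N.emeasure_pair_measure_Times M.emeasure_space_1)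
qed simp

text \<open>The kernel of the Gale matrix is the orthogonal complement of \<open>1\<close> and the
  rows of \<open>X\<close>. Its dimension is the number of rows of \<open>Y\<close>, which are
  independent and lie in it, so they form a basis.\<close>

lemma gale_dual_if_rows_orthogonal:
  fixes X :: "real^'n^'d" and Y :: "real^'n^'k"
  assumes gp: "general_position (\<lambda>i. column i X)" and X: "centered_rows X" and Y: "centered_rows Y"
    and orth: "\<And>i j. X $ i \<bullet> Y $ j = 0" and card: "CARD('n) = CARD('d) + CARD('k) + 1"
  shows "gale_dual (\<lambda>i. column i X) (\<lambda>i. column i Y)"
proof -
  define K where "K = {v. gale_matrix (\<lambda>i. column i X) *v v = 0}"
  define A where "A = span (insert 1 (range (($) X)))"
  have K_eq: "K = {v. 1 \<bullet> v = 0 \<and> (\<forall>i. X $ i \<bullet> v = 0)}"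
    by (simp add: K_def gale_matrix_def vec_eq_iff matrix_vector_mult_def inner_vec_def column_def
        split_option_all)
  have A_sub: "A \<subseteq> {u. \<forall>v\<in>K. u \<bullet> v = 0}"
    unfolding A_def by (rule span_minimal) (auto simp: K_eq subspace_def inner_add_left)
  have K_orth: "K = {v\<in>UNIV. \<forall>u\<in>A. orthogonal u v}"
  proof -
    have "1 \<in> A" "X $ i \<in> A" for i by (simp_all add: A_def span_base)
    then show ?thesis using A_sub unfolding K_eq orthogonal_def by blast
  qed
  \<comment> \<open>The vector \<open>1\<close> is orthogonal to all rows of \<open>X\<close> but
    not to itself, so it adds one dimension to their span.\<close>
  have "range (($) X) \<subseteq> {u. u \<bullet> 1 = 0}"
    using X by (auto simp: centered_rows_def)
  then have "span (range (($) X)) \<subseteq> {u. u \<bullet> 1 = 0}"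
    by (rule span_minimal) (auto simp: subspace_def inner_add_left)
  moreover have "1 \<bullet> (1 :: real^'n) \<noteq> 0" by simp
  ultimately have notin: "1 \<notin> span (range (($) X))" by blast
  have indep: "independent (insert 1 (range (($) X)))"
    by (rule independent_insertI[OF notin]) (use X in \<open>simp add: centered_rows_def\<close>)
  have "1 \<notin> range (($) X)" by (rule contra_subsetD[OF span_superset notin])
  then have "card (insert 1 (range (($) X))) = CARD('d) + 1"
    using X by (simp add: centered_rows_def card_image)
  then have "dim A = CARD('d) + 1"
    unfolding A_def dim_span using dim_eq_card_independent[OF indep] by simp
  moreover have "dim K + dim A = dim (UNIV :: (real^'n) set)"
    unfolding K_orth by (rule dim_subspace_orthogonal_to_vectors) (simp_all add: A_def)
  ultimately have dim: "dim K = CARD('k)" using card by simp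
  have sub: "range (($) Y) \<subseteq> K"
    using Y orth by (auto simp: K_eq centered_rows_def inner_commute)
  have row: "row c Y = Y $ c" for c
    by (simp add: row_def vec_eq_iff)
  have rows: "rows Y = range (($) Y)"
    unfolding rows_def row by auto
  have "subspace K"
    by (auto simp: K_eq subspace_def inner_add_right)
  then have "span (range (($) Y)) \<subseteq> K"
    using sub by (simp add: span_minimal)
  moreover have "K \<subseteq> span (range (($) Y))"
    using Y by (intro card_ge_dim_independent sub) (simp_all add: centered_rows_def card_image dim)
  ultimately have "columns_basis_of (transpose Y) K"
    using Y by (auto simp: columns_basis_of_def row rows centered_rows_def)
  moreover have "column i Y = row i (transpose Y)" for i
    by simp
  ultimately show ?thesis using gp unfolding gale_dual_def K_def by blast
qed

lemma centered_orthonormal_basis: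
  assumes card: "CARD('n) = CARD('q) + 1"
  obtains e :: "'q::finite \<Rightarrow> real^'n"
  where "\<And>i j. e i \<bullet> e j = (if i = j then 1 else 0)" "\<And>i. e i \<bullet> 1 = 0"
proof -
  obtain B where B: "B \<subseteq> {v::real^'n. 1 \<bullet> v = 0}" "pairwise orthogonal B" "\<And>x. x \<in> B \<Longrightarrow> norm x = 1"
      "independent B" "card B = dim {v::real^'n. 1 \<bullet> v = 0}"
    by (metis orthonormal_basis_subspace subspace_hyperplane)
  have "card B = CARD('q)"
    using B(5) card by (simp add: dim_hyperplane)
  then obtain e where e: "bij_betw e (UNIV::'q set) B"
    using B(4) by (metis finite finite_same_card_bij independent_bound)
  then have in_B: "e i \<in> B" and inj: "inj e" for i by (auto simp: bij_betw_def)
  show thesis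
  proof
    show "e i \<bullet> e j = (if i = j then 1 else 0)" for i j
      using B(2,3) in_B[of i] in_B[of j] inj_eq[OF inj]
      by (auto simp: pairwise_def orthogonal_def norm_eq_1)
    show "e i \<bullet> 1 = 0" for i
      using B(1) in_B[of i] by (auto simp: inner_commute)
  qed
qed

section \<open>Construction of the coupling\<close>

theorem lemma9:
  fixes d n :: nat
  assumes "d \<ge> 1" and "n \<ge> d + 2"
    and "CARD('d::finite) = d" and "CARD('n::finite) = n" and "CARD('k::finite) = n - d - 1"
  shows "\<exists>(W :: ((real^'n^'d) \<times> (real^'n^'k)) measure) X Y.
           coupling W X Y (rho :: (real^'n^'d) measure) (rho :: (real^'n^'k) measure) \<and>
           (\<forall>w\<in>space W. gale_dual (\<lambda>i. column i (X w)) (\<lambda>i. column i (Y w)))"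
proof -
  let ?\<rho>d = "rho :: (real^'n^'d) measure" and ?\<rho>k = "rho :: (real^'n^'k) measure"
  let ?\<rho>q = "rho :: (real^'n^('d + 'k)) measure"
  have card: "CARD('n) = CARD('d) + CARD('k) + 1" using assms by simp
  then have card_q: "CARD('n) = CARD('d + 'k) + 1" by simp
  have card_d: "CARD('d) < CARD('n)" and card_k: "CARD('k) < CARD('n)" using card by simp_all
  \<comment> \<open>The sum type indexes a frame of the whole hyperplane; the \<open>Inl\<close>
    part serves the first sample, the \<open>Inr\<close> part the second.\<close>
  obtain e :: "'d + 'k \<Rightarrow> real^'n" where e: "\<And>i j. e i \<bullet> e j = (if i = j then 1 else 0)" "\<And>i. e i \<bullet> 1 = 0"
    using centered_orthonormal_basis[OF card_q] by metis
  interpret D: prob_space ?\<rho>d by (rule prob_space_rho)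
  interpret K: prob_space ?\<rho>k by (rule prob_space_rho)
  interpret Q: prob_space ?\<rho>q by (rule prob_space_rho)
  interpret DK: pair_prob_space ?\<rho>d ?\<rho>k ..
  interpret DKQ: pair_prob_space "?\<rho>d \<Otimes>\<^sub>M ?\<rho>k" ?\<rho>q ..
  have fst_dk: "distr (?\<rho>d \<Otimes>\<^sub>M ?\<rho>k) borel fst = ?\<rho>d"
    using K.distr_pair_fst[of ?\<rho>d] by (simp cong: distr_cong)
  have snd_dk: "distr (?\<rho>d \<Otimes>\<^sub>M ?\<rho>k) borel snd = ?\<rho>k"
    using distr_pair_snd[OF prob_space_rho prob_space_rho] by (simp cong: distr_cong)
  define \<Omega> where "\<Omega> = (?\<rho>d \<Otimes>\<^sub>M ?\<rho>k) \<Otimes>\<^sub>M ?\<rho>q"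
  have snd_\<Omega>: "distr \<Omega> ?\<rho>q snd = ?\<rho>q"
    unfolding \<Omega>_def by (rule distr_pair_snd[OF DK.prob_space_axioms prob_space_rho])
  \<comment> \<open>\<open>F\<close> and \<open>G\<close> share the rotation, which keeps the two
    complementary parts of the frame orthogonal.\<close>
  define F where "F p = map_rows (rotation e (snd p)) (reframe (e \<circ> Inl) (fst (fst p)))"
    for p :: "((real^'n^'d) \<times> (real^'n^'k)) \<times> (real^'n^('d + 'k))"
  define G where "G p = map_rows (rotation e (snd p)) (reframe (e \<circ> Inr) (snd (fst p)))"
    for p :: "((real^'n^'d) \<times> (real^'n^'k)) \<times> (real^'n^('d + 'k))"
  have F: "distr \<Omega> borel F = ?\<rho>d"
    unfolding \<Omega>_def F_def[abs_def]
    by (rule distr_rotated[OF e card_q]) (simp_all add: fst_dk DK.prob_space_axioms)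
  have G: "distr \<Omega> borel G = ?\<rho>k"
    unfolding \<Omega>_def G_def[abs_def]
    by (rule distr_rotated[OF e card_q]) (simp_all add: snd_dk DK.prob_space_axioms)
  have [measurable]: "F \<in> borel_measurable \<Omega>" "G \<in> borel_measurable \<Omega>"
    unfolding \<Omega>_def F_def[abs_def] G_def[abs_def] by measurable
  \<comment> \<open>The joint law is moved to pairs of matrices, so that the coupled variables are
    the two projections.\<close>
  define \<mu> where "\<mu> = distr \<Omega> (?\<rho>d \<Otimes>\<^sub>M ?\<rho>k) (\<lambda>p. (F p, G p))"
  have \<mu>_fst: "distr \<mu> ?\<rho>d fst = ?\<rho>d" and \<mu>_snd: "distr \<mu> ?\<rho>k snd = ?\<rho>k"
    using F G unfolding \<mu>_def by (simp_all add: distr_distr comp_def cong: distr_cong)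
  have [measurable]: "fst \<in> measurable \<mu> ?\<rho>d" "snd \<in> measurable \<mu> ?\<rho>k"
    by (simp_all add: \<mu>_def)
  have "AE w in ?\<rho>q. centered_rows w"
    using card_q by (intro AE_rho_centered_rows) simp
  \<comment> \<open>Reframed rows lie in the spans of disjoint parts of \<open>e\<close> even for
    degenerate \<open>x\<close> and \<open>y\<close>, so orthogonality can be asserted for all of
    them and becomes an event in \<open>w\<close> alone.\<close>
  then have "AE w in distr \<Omega> ?\<rho>q snd. \<forall>x y i j. map_rows (rotation e w) (reframe (e \<circ> Inl) x) $ i \<bullet>
      map_rows (rotation e w) (reframe (e \<circ> Inr) y) $ j = 0"
    unfolding snd_\<Omega>
  proof eventually_elim
    fix w :: "real^'n^('d + 'k)" assume "centered_rows w"
    then obtain Q where Q: "orthogonal_transformation Q" "\<And>v. v \<bullet> 1 = 0 \<Longrightarrow> rotation e w v = Q v"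
      using rotation_orthogonal[OF e card_q] by metis
    show "\<forall>x y i j. map_rows (rotation e w) (reframe (e \<circ> Inl) x) $ i \<bullet>
        map_rows (rotation e w) (reframe (e \<circ> Inr) y) $ j = 0"
    proof (intro allI)
      fix x :: "real^'n^'d" and y :: "real^'n^'k" and i j
      let ?a = "reframe (e \<circ> Inl) x $ i" and ?b = "reframe (e \<circ> Inr) y $ j"
      have "?a \<bullet> 1 = 0" "?b \<bullet> 1 = 0" "?a \<bullet> ?b = 0"
        by (simp_all add: reframe_def inner_sum_left inner_sum_right e)
      then show "map_rows (rotation e w) (reframe (e \<circ> Inl) x) $ i \<bullet>
          map_rows (rotation e w) (reframe (e \<circ> Inr) y) $ j = 0"
        using Q by (simp add: orthogonal_transformation_def)
    qed
  qed
  moreover have "snd \<in> measurable \<Omega> ?\<rho>q" by (simp add: \<Omega>_def)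
  ultimately have "AE p in \<Omega>. \<forall>x y i j. map_rows (rotation e (snd p)) (reframe (e \<circ> Inl) x) $ i \<bullet>
      map_rows (rotation e (snd p)) (reframe (e \<circ> Inr) y) $ j = 0"
    by (rule AE_distrD[rotated])
  then have "AE p in \<Omega>. \<forall>i j. F p $ i \<bullet> G p $ j = 0"
    unfolding F_def G_def by (rule eventually_mono) blast
  moreover have "Measurable.pred (?\<rho>d \<Otimes>\<^sub>M ?\<rho>k) (\<lambda>p. \<forall>i j. fst p $ i \<bullet> snd p $ j = 0)"
  proof -
    have [measurable]: "(\<lambda>p. fst p $ i \<bullet> snd p $ j) \<in> borel_measurable (?\<rho>d \<Otimes>\<^sub>M ?\<rho>k)" for i j
      by measurable
    show ?thesis by measurable
  qed
  ultimately have orth: "AE p in \<mu>. \<forall>i j. fst p $ i \<bullet> snd p $ j = 0"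
    unfolding \<mu>_def by (subst AE_distr_iff) (simp_all add: pred_def)
  \<comment> \<open>Almost sure properties of one sample pass to the coupled pair because the
    marginals are already known.\<close>
  have "AE X in distr \<mu> ?\<rho>d fst. general_position (\<lambda>i. column i X) \<and> centered_rows X"
    unfolding \<mu>_fst using AE_rho_general_position AE_rho_centered_rows[OF card_d] by eventually_elim simp
  from AE_distrD[OF _ this]
  have gp: "AE p in \<mu>. general_position (\<lambda>i. column i (fst p)) \<and> centered_rows (fst p)" by simp
  have "AE Y in distr \<mu> ?\<rho>k snd. centered_rows Y"
    unfolding \<mu>_snd by (rule AE_rho_centered_rows[OF card_k])
  from AE_distrD[OF _ this] have "AE p in \<mu>. centered_rows (snd p)" by simp
  with orth gp have "AE p in \<mu>. gale_dual (\<lambda>i. column i (fst p)) (\<lambda>i. column i (snd p))"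
    by eventually_elim (simp add: gale_dual_if_rows_orthogonal card)
  \<comment> \<open>\<open>N\<close> is a measurable null set that contains the failures of Gale
    duality, whose own measurability is left open.\<close>
  then obtain N where N: "N \<in> null_sets \<mu>"
      "{p\<in>space \<mu>. \<not> gale_dual (\<lambda>i. column i (fst p)) (\<lambda>i. column i (snd p))} \<subseteq> N"
    by (auto simp: eventually_ae_filter)
  define W where "W = restrict_space \<mu> (space \<mu> - N)"
  have "distr W ?\<rho>d fst = ?\<rho>d" "distr W ?\<rho>k snd = ?\<rho>k"
    unfolding W_def by (simp_all add: distr_restrict_conull[OF N(1)] \<mu>_fst \<mu>_snd)
  moreover have meas: "fst \<in> measurable W ?\<rho>d" "snd \<in> measurable W ?\<rho>k"
    unfolding W_def by (auto intro!: measurable_restrict_space1)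
  \<comment> \<open>The total mass of \<open>W\<close> is read off from its image under
    \<open>fst\<close>, which is a probability measure.\<close>
  moreover have "prob_space W"
    using D.prob_space_axioms calculation(1) meas(1) prob_space_distrD by metis
  ultimately have "coupling W fst snd ?\<rho>d ?\<rho>k"
    by (simp add: coupling_def)
  moreover have "\<forall>w\<in>space W. gale_dual (\<lambda>i. column i (fst w)) (\<lambda>i. column i (snd w))"
    using N(2) by (auto simp: W_def space_restrict_space)
  ultimately show ?thesis by blast
qed

end
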